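(* Let $1\le p\le\infty$ (with $1/p:=0$ if $p=\infty$). If $\mu$ is a finite Borel measure on $[-\pi,\pi)$ and $u_r(\theta)=P[\mu](re^{i\theta})$, then $\|u_r\|_p=O\big((1-r)^{1/p-1}\big)$ as $r\to1$. This estimate is sharp: if $\delta$ is the Dirac measure at $0$ and $v_r(\theta)=P[\delta](re^{i\theta})$, then $\|v_r\|_p\ne o\big((1-r)^{1/p-1}\big)$ as $r\to1$.
   Context: The Poisson kernel is $\Phi_r(\theta)=\frac{1-r^2}{2\pi(1-2r\cos\theta+r^2)}$ for $0\le r<1$, $\theta\in\mathbb{R}$. For a finite (positive) Borel measure $\mu$ on $[-\pi,\pi)$ its Poisson integral is $P[\mu](re^{i\theta})=\int_{[-\pi,\pi)}\Phi_r(\phi-\theta)\,d\mu(\phi)$. $\|\cdot\|_p$ is the $L^p$ norm with respect to Lebesgue measure on $[-\pi,\pi]$. Limits $r\to1$ are from below. *)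

theory Defs
  imports "HOL-Probability.Probability" "HOL-Library.Landau_Symbols"
begin

definition poisson_kernel :: "real \<Rightarrow> real \<Rightarrow> real" where
  "poisson_kernel r \<theta> = (1 - r^2) / (2 * pi * (1 - 2 * r * cos \<theta> + r^2))"

text \<open>The space \<open>[-\<pi>, \<pi>)\<close> with its Borel \<open>\<sigma>\<close>-algebra; only its sets are relevant,
  not the measure it carries.\<close>

definition circle_borel :: "real measure" where
  "circle_borel = restrict_space borel {-pi..<pi}"

text \<open>\<open>poisson_integral \<mu> r \<theta>\<close> is the value of \<open>P[\<mu>]\<close> at the point with polar coordinates
  \<open>(r, \<theta>)\<close>.\<close>

definition poisson_integral :: "real measure \<Rightarrow> real \<Rightarrow> real \<Rightarrow> real" where
  "poisson_integral \<mu> r \<theta> = (LINT \<phi>|\<mu>. poisson_kernel r (\<phi> - \<theta>))"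

text \<open>The \<open>L\<^sup>p\<close> norm for \<open>1 \<le> p \<le> \<infinity>\<close>, with the value \<open>\<infinity>\<close> exactly when the function is not
  in \<open>L\<^sup>p\<close>; following \<open>esssup\<close>, this includes the non-measurable functions.\<close>

definition Lp_norm :: "'a measure \<Rightarrow> ennreal \<Rightarrow> ('a \<Rightarrow> real) \<Rightarrow> ennreal" where
  "Lp_norm M p f =
     (if f \<notin> borel_measurable M then \<infinity>
      else if p = \<infinity> then esssup M (\<lambda>x. ennreal \<bar>f x\<bar>)
      else let I = (\<integral>\<^sup>+ x. ennreal (\<bar>f x\<bar> powr enn2real p) \<partial>M)
           in if I = \<infinity> then \<infinity> else ennreal (enn2real I powr (1 / enn2real p)))"

abbreviation circle_norm :: "ennreal \<Rightarrow> (real \<Rightarrow> real) \<Rightarrow> ennreal" where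
  "circle_norm p f \<equiv> Lp_norm (lebesgue_on {-pi..pi}) p f"

end

theory Submission
  imports Defs
begin

text \<open>Testing the kernel against a measure \<open>\<mu>\<close> of total mass \<open>m\<close> gives a function bounded by
  \<open>m / (\<pi> (1 - r))\<close> and, by Tonelli, of \<open>L\<^sup>1\<close> norm \<open>m\<close>; interpolating
  \<open>\<bar>u\<bar>\<^sup>p \<le> \<parallel>u\<parallel>\<^sub>\<infinity>\<^bsup>p-1\<^esup> \<bar>u\<bar>\<close> yields the upper bound. The kernel itself is at least
  \<open>1 / (4 \<pi> (1 - r))\<close> on \<open>[0, 1 - r]\<close>, which shows that the exponent cannot be improved.\<close>

section \<open>Two-sided estimates for \<open>Lp_norm\<close>\<close>

lemma finite_exponentE:
  fixes p :: ennreal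
  assumes "1 \<le> p" "p \<noteq> \<infinity>"
  obtains q where "1 \<le> q" "enn2real p = q" "enn2real (1 / p) = 1 / q"
proof -
  obtain q where q: "p = ennreal q" "0 \<le> q"
    using assms(2) by (cases p) auto
  have "1 \<le> q"
    using assms(1) q by (simp add: ennreal_ge_1)
  moreover have "1 / p = ennreal (1 / q)"
    using \<open>1 \<le> q\<close> q divide_ennreal[of 1 q] by simp
  ultimately show ?thesis
    using that[of q] q by simp
qed

text \<open>Strict positivity of \<open>A\<close> and \<open>B\<close> lets one formula cover both
  endpoints. Since \<open>0 powr 0 = 0\<close>, the bound collapses to \<open>B\<close> at p =
  infinity only because \<open>A powr 0 = 1\<close>, and to \<open>A\<close> at p = 1 only because
  \<open>B powr 0 = 1\<close>.\<close>

lemma Lp_norm_le_interpolate: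
  fixes f :: "'a \<Rightarrow> real"
  assumes p: "1 \<le> p" and f: "f \<in> borel_measurable M"
    and B: "0 < B" "\<And>x. x \<in> space M \<Longrightarrow> \<bar>f x\<bar> \<le> B"
    and A: "0 < A" "(\<integral>\<^sup>+ x. ennreal \<bar>f x\<bar> \<partial>M) \<le> ennreal A"
  shows "Lp_norm M p f \<le> ennreal (A powr enn2real (1 / p) * B powr (1 - enn2real (1 / p)))"
proof (cases "p = \<infinity>")
  case True
  have "esssup M (\<lambda>x. ennreal \<bar>f x\<bar>) \<le> ennreal B"
    using f B by (intro esssup_I) (auto intro!: AE_I2 ennreal_leI)
  then show ?thesis
    using True f A(1) B(1) by (simp add: Lp_norm_def)
next
  case False
  obtain q where q: "1 \<le> q" "enn2real p = q" "enn2real (1 / p) = 1 / q"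
    using finite_exponentE[OF p False] by blast
  define I where "I = (\<integral>\<^sup>+ x. ennreal (\<bar>f x\<bar> powr q) \<partial>M)"
  have "I \<le> (\<integral>\<^sup>+ x. ennreal (B powr (q - 1)) * ennreal \<bar>f x\<bar> \<partial>M)"
    unfolding I_def
  proof (intro nn_integral_mono)
    fix x assume x: "x \<in> space M"
    have "\<bar>f x\<bar> powr q \<le> B powr (q - 1) * \<bar>f x\<bar>"
    \<comment> \<open>Splitting one factor off the power divides by it, so zeros of \<open>f\<close>
      are treated apart; there both sides vanish.\<close>
    proof (cases "f x = 0")
      case False
      have "\<bar>f x\<bar> powr q = \<bar>f x\<bar> powr (q - 1) * \<bar>f x\<bar>"
        using False by (simp add: powr_diff)
      also have "\<dots> \<le> B powr (q - 1) * \<bar>f x\<bar>"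
        using B(2)[OF x] q(1) by (intro mult_right_mono powr_mono2) auto
      finally show ?thesis .
    qed simp
    then show "ennreal (\<bar>f x\<bar> powr q) \<le> ennreal (B powr (q - 1)) * ennreal \<bar>f x\<bar>"
      by (simp add: ennreal_mult[symmetric] ennreal_leI)
  qed
  also have "\<dots> = ennreal (B powr (q - 1)) * (\<integral>\<^sup>+ x. ennreal \<bar>f x\<bar> \<partial>M)"
    using f by (intro nn_integral_cmult) auto
  also have "\<dots> \<le> ennreal (B powr (q - 1)) * ennreal A"
    using A(2) by (intro mult_left_mono) auto
  finally have I: "I \<le> ennreal (B powr (q - 1) * A)"
    using A(1) by (simp add: ennreal_mult)
  then have fin: "I \<noteq> \<infinity>"
    by (auto simp: top_unique)
  have "enn2real I \<le> B powr (q - 1) * A"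
    using A(1) I by (intro enn2real_leI) auto
  then have "enn2real I powr (1 / q) \<le> (B powr (q - 1) * A) powr (1 / q)"
    using q by (intro powr_mono2) auto
  also have "\<dots> = A powr (1 / q) * B powr (1 - 1 / q)"
    using q A B by (simp add: powr_mult powr_powr diff_divide_distrib)
  finally show ?thesis
    using f False fin q by (simp add: Lp_norm_def I_def[symmetric] ennreal_leI)
qed

text \<open>A Chebyshev bound: the absolute value of \<open>f\<close> dominates \<open>B\<close>
  times the indicator of \<open>E\<close>, whose norm is \<open>a powr (1/p) * B\<close>. For p =
  infinity the factor in \<open>a\<close> is 1, and \<open>0 < a\<close> prevents \<open>E\<close>
  from being negligible.\<close>

lemma Lp_norm_ge_on_set:
  fixes f :: "'a \<Rightarrow> real"
  assumes p: "1 \<le> p" and E: "E \<in> sets M" "emeasure M E = ennreal a" "0 < a"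
    and B: "0 < B" "\<And>x. x \<in> E \<Longrightarrow> B \<le> \<bar>f x\<bar>"
  shows "ennreal (a powr enn2real (1 / p) * B) \<le> Lp_norm M p f"
proof (cases "f \<in> borel_measurable M")
  case False
  then show ?thesis by (simp add: Lp_norm_def)
next
  case f: True
  show ?thesis
  proof (cases "p = \<infinity>")
    case True
    have "ennreal B \<le> esssup M (\<lambda>x. ennreal \<bar>f x\<bar>)"
    \<comment> \<open>An essential supremum below \<open>B\<close> would make almost every point
      avoid \<open>E\<close>, so \<open>E\<close> would be a null set.\<close>
    proof (rule ccontr)
      assume "\<not> ?thesis"
      then have less: "esssup M (\<lambda>x. ennreal \<bar>f x\<bar>) < ennreal B"
        by simp
      have "AE x in M. ennreal \<bar>f x\<bar> \<le> esssup M (\<lambda>x. ennreal \<bar>f x\<bar>)"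
        by (rule esssup_AE)
      then have "AE x in M. x \<notin> E"
      proof (eventually_elim, safe)
        fix x assume "ennreal \<bar>f x\<bar> \<le> esssup M (\<lambda>x. ennreal \<bar>f x\<bar>)" "x \<in> E"
        then show False
          using less B(2)[of x] ennreal_leI[of B "\<bar>f x\<bar>"] by (meson leD le_less_trans)
      qed
      then have "emeasure M E = 0"
        using E(1) by (subst (asm) AE_iff_measurable[OF E(1)])
          (use sets.sets_into_space[OF E(1)] in auto)
      with E show False by simp
    qed
    then show ?thesis
      using True f E(3) by (simp add: Lp_norm_def)
  next
    case False
    obtain q where q: "1 \<le> q" "enn2real p = q" "enn2real (1 / p) = 1 / q"
      using finite_exponentE[OF p False] by blast
    define I where "I = (\<integral>\<^sup>+ x. ennreal (\<bar>f x\<bar> powr q) \<partial>M)"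
    show ?thesis
    proof (cases "I = \<infinity>")
      case True
      then show ?thesis
        using f False q by (simp add: Lp_norm_def I_def[symmetric])
    next
      case fin: False
      have "ennreal (B powr q * a) = (\<integral>\<^sup>+ x. ennreal (B powr q) * indicator E x \<partial>M)"
        using E by (simp add: nn_integral_cmult_indicator ennreal_mult)
      also have "\<dots> \<le> I"
        unfolding I_def using B q
        by (intro nn_integral_mono)
          (auto split: split_indicator intro!: ennreal_leI powr_mono2)
      also have "I = ennreal (enn2real I)"
        using fin by (simp add: less_top)
      finally have "B powr q * a \<le> enn2real I"
        by (simp add: ennreal_le_iff)
      then have "(B powr q * a) powr (1 / q) \<le> enn2real I powr (1 / q)"
        using q E B by (intro powr_mono2) auto
      moreover have "(B powr q * a) powr (1 / q) = a powr (1 / q) * B"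
        using q E B by (simp add: powr_mult powr_powr)
      ultimately show ?thesis
        using f False fin q by (simp add: Lp_norm_def I_def[symmetric] ennreal_leI)
    qed
  qed
qed

section \<open>The Poisson kernel: pointwise bounds and total mass\<close>

lemma poisson_denominator_ge:
  fixes r :: real
  assumes "0 \<le> r"
  shows "(1 - r)\<^sup>2 \<le> 1 - 2 * r * cos x + r\<^sup>2"
  \<comment> \<open>The two sides differ by 2 r (1 - cos x). The right one is the squared modulus of
    1 - r e^(ix), which is smallest at x = 0.\<close>
  using mult_left_mono[OF cos_le_one[of x], of r] assms by (simp add: power2_eq_square algebra_simps)

lemma poisson_denominator_pos:
  fixes r :: real
  assumes "0 \<le> r" "r < 1"
  shows "0 < 1 - 2 * r * cos x + r\<^sup>2"
proof -
  have "0 < (1 - r)\<^sup>2" using assms by simp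
  then show ?thesis using poisson_denominator_ge[OF assms(1), of x] by linarith
qed

lemma poisson_kernel_nonneg:
  assumes "0 \<le> r" "r < 1"
  shows "0 \<le> poisson_kernel r x"
  using poisson_denominator_pos[OF assms, of x] assms
  by (auto simp: poisson_kernel_def abs_square_le_1 intro!: divide_nonneg_pos)

text \<open>The peak value at x = 0 is (1 + r) / (2 pi (1 - r)), and 1 + r <= 2.\<close>

lemma poisson_kernel_le:
  assumes "0 \<le> r" "r < 1"
  shows "poisson_kernel r x \<le> 1 / (pi * (1 - r))"
proof -
  have "poisson_kernel r x \<le> (1 - r\<^sup>2) / (2 * pi * (1 - r)\<^sup>2)"
    unfolding poisson_kernel_def
    using poisson_denominator_ge[OF assms(1), of x] assms
    by (intro divide_left_mono mult_left_mono mult_pos_pos poisson_denominator_pos)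
      (auto simp: abs_square_le_1)
  also have "\<dots> = ((1 + r) / 2) / (pi * (1 - r))"
    using assms by (simp add: power2_eq_square divide_simps) (simp add: algebra_simps)
  also have "\<dots> \<le> 1 / (pi * (1 - r))"
    using assms by (intro divide_right_mono) auto
  finally show ?thesis .
qed

text \<open>The peak has width of order 1 - r. The denominator is (1 - r)^2 + 2 r (1 - cos x), and 1
  - cos x <= x^2 / 2 bounds the second term by (1 - r)^2, so on this interval the denominator at
  most doubles its minimum. The factor 1 + r >= 1 left by 1 - r^2 is then dropped.\<close>

lemma poisson_kernel_ge:
  assumes r: "0 \<le> r" "r < 1" and x: "\<bar>x\<bar> \<le> 1 - r"
  shows "1 / (4 * pi * (1 - r)) \<le> poisson_kernel r x"
proof -
  have "x\<^sup>2 \<le> (1 - r)\<^sup>2"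
    using x r by (simp add: abs_le_square_iff[symmetric])
  moreover have "1 - x\<^sup>2 / 2 \<le> cos x"
  proof -
    have "cos x = 1 - 2 * (sin (x / 2))\<^sup>2"
      using cos_double_sin[of "x / 2"] by simp
    moreover have "(sin (x / 2))\<^sup>2 \<le> (x / 2)\<^sup>2"
      using abs_sin_x_le_abs_x[of "x / 2"] by (simp add: abs_le_square_iff[symmetric])
    ultimately show ?thesis by (simp add: power_divide)
  qed
  then have "r * (1 - cos x) \<le> 1 * (x\<^sup>2 / 2)"
    using r by (intro mult_mono) auto
  ultimately have den: "1 - 2 * r * cos x + r\<^sup>2 \<le> 2 * (1 - r)\<^sup>2"
    by (simp add: power2_eq_square algebra_simps)
  have "1 / (4 * pi * (1 - r)) \<le> (1 + r) / (4 * pi * (1 - r))"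
    using r by (intro divide_right_mono) auto
  also have "\<dots> = (1 - r\<^sup>2) / (2 * pi * (2 * (1 - r)\<^sup>2))"
    using r by (simp add: power2_eq_square divide_simps) (simp add: algebra_simps)
  also have "\<dots> \<le> poisson_kernel r x"
    unfolding poisson_kernel_def using den r
    by (intro divide_left_mono mult_left_mono mult_pos_pos poisson_denominator_pos)
      (auto simp: abs_square_le_1)
  finally show ?thesis .
qed

text \<open>Unlike the usual \<open>arctan ((1 + r) / (1 - r) * tan (x / 2))\<close>, this antiderivative is smooth
  on the whole line, being half the angle plus the argument of \<open>1 / (1 - r e\<^bsup>ix\<^esup>)\<close>.\<close>

lemma poisson_kernel_antiderivative:
  assumes r: "0 \<le> r" "r < 1"
  shows "((\<lambda>x. (x / 2 + arctan (r * sin x / (1 - r * cos x))) / pi)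
           has_real_derivative poisson_kernel r x) (at x)"
proof -
  have "r * cos x \<le> r * 1"
    using r by (intro mult_left_mono) auto
  then have c: "0 < 1 - r * cos x"
    using r by linarith
  have d: "0 < 1 - 2 * r * cos x + r\<^sup>2"
    by (rule poisson_denominator_pos[OF r])
  have s: "(r * sin x)\<^sup>2 = r\<^sup>2 - (r * cos x)\<^sup>2"
    by (simp add: power_mult_distrib sin_squared_eq algebra_simps)
  \<comment> \<open>With z = 1 - r e^(ix), the argument of \<open>arctan\<close> is -Im z / Re z,
    and this is 1 + tan^2 = |z|^2 / (Re z)^2.\<close>
  have sq: "1 + (r * sin x / (1 - r * cos x))\<^sup>2 = (1 - 2 * r * cos x + r\<^sup>2) / (1 - r * cos x)\<^sup>2"
    unfolding power_divide s using c by (simp add: divide_simps) (simp add: power2_eq_square algebra_simps)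
  have num: "r * cos x * (1 - r * cos x) - r * sin x * (r * sin x) = r * cos x - r\<^sup>2"
    using s by (simp add: power2_eq_square algebra_simps)
  have "((\<lambda>x. r * sin x / (1 - r * cos x)) has_real_derivative
      (r * cos x * (1 - r * cos x) - r * sin x * (r * sin x)) / ((1 - r * cos x) * (1 - r * cos x))) (at x)"
    using c by (intro DERIV_divide) (auto intro!: derivative_eq_intros)
  then have "((\<lambda>x. r * sin x / (1 - r * cos x)) has_real_derivative
      (r * cos x - r\<^sup>2) / (1 - r * cos x)\<^sup>2) (at x)"
    unfolding num power2_eq_square[of "1 - r * cos x"] .
  then have "((\<lambda>x. arctan (r * sin x / (1 - r * cos x))) has_real_derivative
      inverse (1 + (r * sin x / (1 - r * cos x))\<^sup>2) * ((r * cos x - r\<^sup>2) / (1 - r * cos x)\<^sup>2)) (at x)"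
    by (rule DERIV_chain2[OF DERIV_arctan])
  also have "inverse (1 + (r * sin x / (1 - r * cos x))\<^sup>2) * ((r * cos x - r\<^sup>2) / (1 - r * cos x)\<^sup>2)
      = (r * cos x - r\<^sup>2) / (1 - 2 * r * cos x + r\<^sup>2)"
    unfolding sq using c by simp
  finally have "((\<lambda>x. (x / 2 + arctan (r * sin x / (1 - r * cos x))) / pi) has_real_derivative
      (1 / 2 + (r * cos x - r\<^sup>2) / (1 - 2 * r * cos x + r\<^sup>2)) / pi) (at x)"
    by (intro DERIV_cdivide DERIV_add) (auto intro!: derivative_eq_intros)
  \<comment> \<open>Over the common denominator 2 D, the numerator D + 2 r cos x - 2 r^2 collapses
    to 1 - r^2.\<close>
  moreover have "1 / 2 + (r * cos x - r\<^sup>2) / D = (1 - r\<^sup>2) / (2 * D)"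
    if "D = 1 - 2 * r * cos x + r\<^sup>2" "0 < D" for D
    using that by (simp add: field_simps)
  then have "(1 / 2 + (r * cos x - r\<^sup>2) / (1 - 2 * r * cos x + r\<^sup>2)) / pi = poisson_kernel r x"
    using d by (simp add: poisson_kernel_def mult_ac)
  ultimately show ?thesis by simp
qed

lemma poisson_kernel_measurable [measurable]:
  "poisson_kernel r \<in> borel_measurable borel"
  unfolding poisson_kernel_def by measurable

text \<open>The integration runs over a full period, so the \<open>arctan\<close> terms of the
  antiderivative cancel. The linear term x / (2 pi) grows by exactly 1 over length 2 pi.\<close>

lemma nn_integral_poisson_kernel:
  assumes r: "0 \<le> r" "r < 1"
  shows "(\<integral>\<^sup>+ \<theta>. ennreal (poisson_kernel r (\<phi> - \<theta>)) * indicator {-pi..pi} \<theta> \<partial>lborel) = 1"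
proof -
  define F where "F = (\<lambda>x. (x / 2 + arctan (r * sin x / (1 - r * cos x))) / pi)"
  \<comment> \<open>The sign compensates the inner derivative -1 of \<phi> - \<theta> with respect
    to \<theta>.\<close>
  have "((\<lambda>\<theta>. - F (\<phi> - \<theta>)) has_real_derivative poisson_kernel r (\<phi> - \<theta>)) (at \<theta>)" for \<theta>
    unfolding F_def
    by (rule DERIV_cong, rule DERIV_minus,
        rule DERIV_chain2[OF poisson_kernel_antiderivative[OF r]])
      (auto intro!: derivative_eq_intros)
  then have "(\<integral>\<^sup>+ \<theta>. ennreal (poisson_kernel r (\<phi> - \<theta>)) * indicator {-pi..pi} \<theta> \<partial>lborel)
      = ennreal (- F (\<phi> - pi) - - F (\<phi> - (- pi)))"
    by (intro nn_integral_FTC_Icc)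
      (auto intro: poisson_kernel_nonneg[OF r] has_field_derivative_at_within)
  also have "- F (\<phi> - pi) - - F (\<phi> - (- pi)) = 1"
    by (simp add: F_def add_divide_distrib diff_divide_distrib)
  finally show ?thesis by simp
qed

section \<open>Poisson integrals of finite measures: sup, L^1 and L^p bounds\<close>

lemma measurable_circle_borel_id:
  assumes "sets \<mu> = sets circle_borel"
  shows "(\<lambda>x. x) \<in> measurable \<mu> borel"
proof -
  have "(\<lambda>x. x) \<in> measurable circle_borel borel"
    unfolding circle_borel_def by (intro measurable_restrict_space1) simp
  then show ?thesis
    using measurable_cong_sets[OF assms refl] by blast
qed

text \<open>Bridges the completed measure behind \<open>circle_norm\<close> and
  \<open>lborel\<close>, on which the kernel mass and Tonelli's theorem are stated.\<close>

lemma nn_integral_lebesgue_on: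
  assumes "g \<in> borel_measurable borel" "E \<in> sets borel"
  shows "(\<integral>\<^sup>+ x. g x \<partial>lebesgue_on E) = (\<integral>\<^sup>+ x. g x * indicator E x \<partial>lborel)"
  using assms by (simp add: nn_integral_restrict_space nn_integral_completion)

context
  fixes \<mu> :: "real measure" and r :: real
  assumes fin: "finite_measure \<mu>" and sets: "sets \<mu> = sets circle_borel"
    and r: "0 \<le> r" "r < 1"
begin

interpretation finite_measure \<mu> by (rule fin)

lemma poisson_kernel_pair_measurable:
  "(\<lambda>(\<theta>, \<phi>). poisson_kernel r (\<phi> - \<theta>)) \<in> borel_measurable (lborel \<Otimes>\<^sub>M \<mu>)"
  using measurable_circle_borel_id[OF sets] by measurable

lemma poisson_kernel_translate_measurable:
  "(\<lambda>\<phi>. poisson_kernel r (\<phi> - \<theta>)) \<in> borel_measurable \<mu>"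
  using measurable_circle_borel_id[OF sets] by measurable

text \<open>A bounded measurable function is integrable for a finite measure. This rules out the
  default value 0 of the Bochner integral, so that \<open>poisson_integral\<close> is the true
  integral.\<close>

lemma poisson_kernel_translate_integrable: "integrable \<mu> (\<lambda>\<phi>. poisson_kernel r (\<phi> - \<theta>))"
  using poisson_kernel_nonneg[OF r] poisson_kernel_le[OF r] poisson_kernel_translate_measurable
  by (intro integrable_const_bound[where B = "1 / (pi * (1 - r))"]) auto

lemma poisson_integral_measurable: "poisson_integral \<mu> r \<in> borel_measurable borel"
  unfolding poisson_integral_def
  using borel_measurable_lebesgue_integral[OF poisson_kernel_pair_measurable] by simp

lemma poisson_integral_nonneg: "0 \<le> poisson_integral \<mu> r \<theta>"
  unfolding poisson_integral_def by (intro integral_nonneg_AE AE_I2 poisson_kernel_nonneg r)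

lemma poisson_integral_le: "poisson_integral \<mu> r \<theta> \<le> measure \<mu> (space \<mu>) / (pi * (1 - r))"
proof -
  have "poisson_integral \<mu> r \<theta> \<le> (LINT \<phi>|\<mu>. 1 / (pi * (1 - r)))"
    unfolding poisson_integral_def
    by (intro integral_mono poisson_kernel_translate_integrable poisson_kernel_le r) simp
  then show ?thesis by simp
qed

lemma nn_integral_poisson_integral:
  "(\<integral>\<^sup>+ \<theta>. ennreal (poisson_integral \<mu> r \<theta>) \<partial>lebesgue_on {-pi..pi}) = emeasure \<mu> (space \<mu>)"
proof -
  interpret P: pair_sigma_finite lborel \<mu> ..
  have eq: "ennreal (poisson_integral \<mu> r \<theta>) = (\<integral>\<^sup>+ \<phi>. ennreal (poisson_kernel r (\<phi> - \<theta>)) \<partial>\<mu>)" for \<theta>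
    unfolding poisson_integral_def
    by (rule nn_integral_eq_integral[symmetric])
      (auto intro: poisson_kernel_translate_integrable poisson_kernel_nonneg r)
  have meas: "(\<lambda>(\<theta>, \<phi>). ennreal (poisson_kernel r (\<phi> - \<theta>)) * indicator {-pi..pi} \<theta>)
      \<in> borel_measurable (lborel \<Otimes>\<^sub>M \<mu>)"
    using measurable_circle_borel_id[OF sets] by measurable
  have "(\<integral>\<^sup>+ \<theta>. ennreal (poisson_integral \<mu> r \<theta>) \<partial>lebesgue_on {-pi..pi})
      = (\<integral>\<^sup>+ \<theta>. ennreal (poisson_integral \<mu> r \<theta>) * indicator {-pi..pi} \<theta> \<partial>lborel)"
    using poisson_integral_measurable by (intro nn_integral_lebesgue_on) auto
  also have "\<dots> = (\<integral>\<^sup>+ \<theta>. \<integral>\<^sup>+ \<phi>. ennreal (poisson_kernel r (\<phi> - \<theta>)) * indicator {-pi..pi} \<theta> \<partial>\<mu> \<partial>lborel)"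
    unfolding eq using poisson_kernel_translate_measurable
    by (simp add: nn_integral_multc)
  \<comment> \<open>Tonelli: after the exchange, the inner integral over \<theta> is 1 for every
    \<phi>.\<close>
  also have "\<dots> = (\<integral>\<^sup>+ \<phi>. \<integral>\<^sup>+ \<theta>. ennreal (poisson_kernel r (\<phi> - \<theta>)) * indicator {-pi..pi} \<theta> \<partial>lborel \<partial>\<mu>)"
    using P.Fubini'[OF meas] by simp
  also have "\<dots> = emeasure \<mu> (space \<mu>)"
    by (simp add: nn_integral_poisson_kernel[OF r])
  finally show ?thesis .
qed

text \<open>Adding 1 to the mass keeps \<open>m\<close> positive even for the zero measure, as the
  interpolation requires.\<close>

lemma circle_norm_poisson_integral_le:
  fixes p :: ennreal
  assumes "1 \<le> p"
  defines "m \<equiv> measure \<mu> (space \<mu>) + 1" and "s \<equiv> enn2real (1 / p)"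
  shows "circle_norm p (poisson_integral \<mu> r)
           \<le> ennreal (m powr s * (m / pi) powr (1 - s) * (1 - r) powr (s - 1))"
proof -
  have m: "0 < m" "measure \<mu> (space \<mu>) \<le> m"
    by (auto simp: m_def intro: add_nonneg_pos)
  have "circle_norm p (poisson_integral \<mu> r)
      \<le> ennreal (m powr s * (m / (pi * (1 - r))) powr (1 - s))"
    unfolding s_def
  proof (rule Lp_norm_le_interpolate[OF assms(1)])
    show "poisson_integral \<mu> r \<in> borel_measurable (lebesgue_on {-pi..pi})"
      using poisson_integral_measurable
      by (intro measurable_restrict_space1 measurable_completion) simp
    show "\<bar>poisson_integral \<mu> r x\<bar> \<le> m / (pi * (1 - r))" for x
      using poisson_integral_nonneg[of x] poisson_integral_le[of x] m r
        divide_right_mono[OF m(2), of "pi * (1 - r)"] by simp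
    show "(\<integral>\<^sup>+ x. ennreal \<bar>poisson_integral \<mu> r x\<bar> \<partial>lebesgue_on {-pi..pi}) \<le> ennreal m"
      using nn_integral_poisson_integral poisson_integral_nonneg m
      by (simp add: emeasure_eq_measure ennreal_leI)
  qed (use m r in auto)
  also have "(m / (pi * (1 - r))) powr (1 - s) = (m / pi) powr (1 - s) * (1 - r) powr (s - 1)"
  proof -
    have "(m / pi / (1 - r)) powr (1 - s) = (m / pi) powr (1 - s) / (1 - r) powr (1 - s)"
      by (rule powr_divide)
    then show ?thesis
      using powr_minus_divide[of "1 - r" "1 - s"] by simp
  qed
  finally show ?thesis by (simp add: mult.assoc)
qed

end

section \<open>The Dirac measure, sharpness and the asymptotic statement\<close>

lemma poisson_integral_return:
  "poisson_integral (return circle_borel 0) r \<theta> = poisson_kernel r \<theta>"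
proof -
  have "0 \<in> space circle_borel"
    by (simp add: circle_borel_def space_restrict_space)
  moreover have "(\<lambda>\<phi>. poisson_kernel r (\<phi> - \<theta>)) \<in> borel_measurable circle_borel"
    using measurable_circle_borel_id[OF refl] by measurable
  \<comment> \<open>Evaluation at 0 gives the kernel at -\<theta>; the kernel is even because cosine
    is.\<close>
  ultimately show ?thesis
    by (simp add: poisson_integral_def integral_return) (simp add: poisson_kernel_def)
qed

lemma circle_norm_poisson_kernel_ge:
  fixes p :: ennreal
  assumes p: "1 \<le> p" and r: "0 \<le> r" "r < 1"
  shows "ennreal (1 / (4 * pi) * (1 - r) powr (enn2real (1 / p) - 1))
           \<le> circle_norm p (poisson_integral (return circle_borel 0) r)"
proof -
  \<comment> \<open>As 1 - r <= 1 < pi, the peak interval lies inside the circle interval and keeps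
    its full measure 1 - r.\<close>
  have sub: "{0..1 - r} \<subseteq> {-pi..pi}"
    using r pi_gt3 by auto
  have "ennreal ((1 - r) powr enn2real (1 / p) * (1 / (4 * pi * (1 - r))))
      \<le> circle_norm p (poisson_integral (return circle_borel 0) r)"
  proof (rule Lp_norm_ge_on_set[OF p, of "{0..1 - r}"])
    show "{0..1 - r} \<in> sets (lebesgue_on {-pi..pi})"
      using sub by (simp add: sets_restrict_space_iff)
    show "emeasure (lebesgue_on {-pi..pi}) {0..1 - r} = ennreal (1 - r)"
      using sub r by (simp add: emeasure_restrict_space)
    show "1 / (4 * pi * (1 - r)) \<le> \<bar>poisson_integral (return circle_borel 0) r x\<bar>"
      if "x \<in> {0..1 - r}" for x
      using poisson_kernel_ge[OF r, of x] that by (simp add: poisson_integral_return)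
  qed (use r in auto)
  also have "(1 - r) powr enn2real (1 / p) * (1 / (4 * pi * (1 - r)))
      = 1 / (4 * pi) * (1 - r) powr (enn2real (1 / p) - 1)"
    using r by (simp add: powr_diff)
  finally show ?thesis .
qed

text \<open>\<open>enn2real\<close> sends infinity to 0, so the O-estimate alone would not exclude
  infinite norms; the eventual finiteness clause does.\<close>

theorem mainTheorem2:
  fixes p :: ennreal
  assumes "1 \<le> p"
  shows "(\<forall>\<mu> :: real measure. finite_measure \<mu> \<and> sets \<mu> = sets circle_borel \<longrightarrow>
            (\<forall>\<^sub>F r in at_left 1. circle_norm p (poisson_integral \<mu> r) < \<infinity>) \<and>
            (\<lambda>r. enn2real (circle_norm p (poisson_integral \<mu> r)))
              \<in> O[at_left 1](\<lambda>r. (1 - r) powr (enn2real (1 / p) - 1)))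
       \<and> (\<lambda>r. enn2real (circle_norm p (poisson_integral (return circle_borel 0) r)))
              \<notin> o[at_left 1](\<lambda>r. (1 - r) powr (enn2real (1 / p) - 1))"
proof -
  define s where "s = enn2real (1 / p)"
  have ev: "\<forall>\<^sub>F r :: real in at_left 1. r \<in> {0<..<1}"
    by (rule eventually_at_left_real) simp
  have upper: "(\<forall>\<^sub>F r in at_left 1. circle_norm p (poisson_integral \<mu> r) < \<infinity>) \<and>
      (\<lambda>r. enn2real (circle_norm p (poisson_integral \<mu> r))) \<in> O[at_left 1](\<lambda>r. (1 - r) powr (s - 1))"
    if \<mu>: "finite_measure \<mu>" "sets \<mu> = sets circle_borel" for \<mu> :: "real measure"
  proof -
    define m where "m = measure \<mu> (space \<mu>) + 1"
    have bound: "\<forall>\<^sub>F r in at_left 1. circle_norm p (poisson_integral \<mu> r)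
        \<le> ennreal (m powr s * (m / pi) powr (1 - s) * (1 - r) powr (s - 1))"
      using ev by eventually_elim
        (use circle_norm_poisson_integral_le[OF \<mu> _ _ assms] in \<open>auto simp: m_def s_def\<close>)
    have "\<forall>\<^sub>F r in at_left 1. circle_norm p (poisson_integral \<mu> r) < \<infinity>"
      using bound by eventually_elim (auto elim: le_less_trans)
    moreover have "\<forall>\<^sub>F r in at_left 1. norm (enn2real (circle_norm p (poisson_integral \<mu> r)))
        \<le> m powr s * (m / pi) powr (1 - s) * norm ((1 - r) powr (s - 1))"
      using bound by eventually_elim (auto intro: enn2real_leI)
    ultimately show ?thesis
      by (blast intro: bigoI)
  qed
  have fin: "finite_measure (return circle_borel 0)"
    by (intro prob_space.finite_measure prob_space_return)
      (simp add: circle_borel_def space_restrict_space)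
  have "(\<lambda>r. enn2real (circle_norm p (poisson_integral (return circle_borel 0) r)))
      \<notin> o[at_left 1](\<lambda>r. (1 - r) powr (s - 1))" (is "?v \<notin> _")
  proof
    assume "?v \<in> o[at_left 1](\<lambda>r. (1 - r) powr (s - 1))"
    \<comment> \<open>The constant is half of the 1 / (4 pi) in the lower bound; any smaller
      positive one would contradict it as well.\<close>
    then have "\<forall>\<^sub>F r in at_left 1. norm (?v r) \<le> 1 / (8 * pi) * norm ((1 - r) powr (s - 1))"
      by (rule landau_o.smallD) simp
    \<comment> \<open>Finiteness, taken from the upper bound for the Dirac measure, lets the lower
      bound pass through \<open>enn2real\<close>, which is monotone only below infinity.\<close>
    moreover have "\<forall>\<^sub>F r in at_left 1.
        circle_norm p (poisson_integral (return circle_borel 0) r) < \<infinity>"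
      using upper[OF fin] by simp
    ultimately have "\<forall>\<^sub>F r :: real in at_left 1. False"
      using ev
    proof eventually_elim
      case (elim r)
      have "1 / (4 * pi) * (1 - r) powr (s - 1) \<le> ?v r"
        using enn2real_mono[OF circle_norm_poisson_kernel_ge[OF assms, of r]] elim
        by (simp add: s_def)
      also have "\<dots> \<le> 1 / (8 * pi) * (1 - r) powr (s - 1)"
        using elim(1) by (simp only: real_norm_def abs_of_nonneg[OF enn2real_nonneg] abs_of_nonneg[OF powr_ge_zero])
      finally have "1 / (4 * pi) * (1 - r) powr (s - 1) \<le> 1 / (8 * pi) * (1 - r) powr (s - 1)" .
      moreover have "0 < (1 - r) powr (s - 1)"
        using elim by simp
      ultimately show False
        by (simp add: field_simps)
    qed
    then show False
      by simp
  qed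
  then show ?thesis
    using upper by (auto simp: s_def)
qed

end
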